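(* Let $\{g_n\}_{n=0}^\infty$ be a stable normalized Bessel sequence in a Hilbert space $\mathcal H$. Then there exists a unique admissible sequence $\{e_n\}_{n=0}^\infty$ of unit vectors in $\mathcal H$ such that $$g_0=e_0,\qquad g_n=e_n-\sum_{i=0}^{n-1}\langle e_n,e_i\rangle g_i\quad (n\ge 1).$$ Moreover, the sequence $\{e_n\}_{n=0}^\infty$ is stable.
   Context: Hilbert spaces are complex, with inner product linear in the first variable. A set of vectors is linearly dense if its linear span is dense in $\mathcal H$. A sequence $\{g_n\}_{n=0}^\infty$ in $\mathcal H$ is a normalized Bessel sequence if $\sum_{n=0}^\infty |\langle x,g_n\rangle|^2\le \|x\|^2$ for all $x\in\mathcal H$ and $\|g_0\|=1$. A normalized Bessel sequence $\{g_n\}_{n=0}^\infty$ is stable if for every $N$ the set $\{g_0\}\cup\{g_n\}_{n=N}^\infty$ is linearly dense. A sequence of unit vectors $\{e_n\}_{n=0}^\infty$ is stable if for every $N$ the set $\{e_n\}_{n=N}^\infty$ is linearly dense. A sequence of unit vectors $\{e_n\}_{n=0}^\infty$ is admissible if $\langle e_n,e_{n+1}\rangle\ge 0$ (i.e. is real and nonnegative) for all $n\ge 0$. *)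

theory Defs
  imports "HOL-Analysis.Analysis"
begin

text \<open>
  Complex inner product spaces on top of the library's real normed spaces, so that norm, topology
  and completeness are the library's. The inner product is linear in the first argument.
\<close>

class complex_inner = real_normed_vector +
  fixes scaleC :: "complex \<Rightarrow> 'a \<Rightarrow> 'a"  (infixr \<open>*\<^sub>C\<close> 75)
    and cinner :: "'a \<Rightarrow> 'a \<Rightarrow> complex"
  assumes scaleC_add_right: "a *\<^sub>C (x + y) = a *\<^sub>C x + a *\<^sub>C y"
    and scaleC_add_left: "(a + b) *\<^sub>C x = a *\<^sub>C x + b *\<^sub>C x"
    and scaleC_scaleC: "a *\<^sub>C (b *\<^sub>C x) = (a * b) *\<^sub>C x"
    and scaleC_one: "1 *\<^sub>C x = x"
    and scaleR_eq_scaleC: "r *\<^sub>R x = complex_of_real r *\<^sub>C x"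
    and cinner_commute: "cinner x y = cnj (cinner y x)"
    and cinner_add_left: "cinner (x + y) z = cinner x z + cinner y z"
    and cinner_scaleC_left: "cinner (a *\<^sub>C x) y = a * cinner x y"
    and cinner_ge_zero: "0 \<le> Re (cinner x x)"
    and cinner_eq_zero_iff: "cinner x x = 0 \<longleftrightarrow> x = 0"
    and norm_eq_sqrt_cinner: "norm x = sqrt (Re (cinner x x))"

class complex_hilbert = complex_inner + complete_space

interpretation complex_vector: vector_space "scaleC :: complex \<Rightarrow> 'a::complex_inner \<Rightarrow> 'a"
  by unfold_locales (simp_all add: scaleC_add_right scaleC_add_left scaleC_scaleC scaleC_one)

instantiation complex :: complex_hilbert
begin

definition scaleC_complex :: "complex \<Rightarrow> complex \<Rightarrow> complex"
  where "scaleC_complex a x = a * x"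

definition cinner_complex :: "complex \<Rightarrow> complex \<Rightarrow> complex"
  where "cinner_complex x y = x * cnj y"

instance
  by intro_classes
    (simp_all add: scaleC_complex_def cinner_complex_def algebra_simps scaleR_conv_of_real
      cmod_def power2_eq_square)

end

definition linearly_dense :: "'a::complex_inner set \<Rightarrow> bool"
  where "linearly_dense S \<longleftrightarrow> closure (complex_vector.span S) = UNIV"

definition normalized_Bessel :: "(nat \<Rightarrow> 'a::complex_inner) \<Rightarrow> bool"
  where "normalized_Bessel g \<longleftrightarrow>
    (\<forall>x. summable (\<lambda>n. (cmod (cinner x (g n)))\<^sup>2) \<and>
         (\<Sum>n. (cmod (cinner x (g n)))\<^sup>2) \<le> (norm x)\<^sup>2) \<and>
    norm (g 0) = 1"

definition stable_normalized_Bessel :: "(nat \<Rightarrow> 'a::complex_inner) \<Rightarrow> bool"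
  where "stable_normalized_Bessel g \<longleftrightarrow>
    normalized_Bessel g \<and> (\<forall>N. linearly_dense ({g 0} \<union> g ` {N..}))"

definition unit_sequence :: "(nat \<Rightarrow> 'a::complex_inner) \<Rightarrow> bool"
  where "unit_sequence e \<longleftrightarrow> (\<forall>n. norm (e n) = 1)"

definition stable_unit_sequence :: "(nat \<Rightarrow> 'a::complex_inner) \<Rightarrow> bool"
  where "stable_unit_sequence e \<longleftrightarrow>
    unit_sequence e \<and> (\<forall>N. linearly_dense (e ` {N..}))"

definition admissible_unit_sequence :: "(nat \<Rightarrow> 'a::complex_inner) \<Rightarrow> bool"
  where "admissible_unit_sequence e \<longleftrightarrow>
    unit_sequence e \<and> (\<forall>n. cinner (e n) (e (Suc n)) \<in> \<real>\<^sub>\<ge>\<^sub>0)"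

definition generates :: "(nat \<Rightarrow> 'a::complex_inner) \<Rightarrow> (nat \<Rightarrow> 'a) \<Rightarrow> bool"
  where "generates e g \<longleftrightarrow>
    g 0 = e 0 \<and> (\<forall>n\<ge>1. g n = e n - (\<Sum>i<n. cinner (e n) (e i) *\<^sub>C g i))"

end

theory Submission
  imports Defs
begin

text \<open>
  Let \<open>P\<^sub>k x = x - \<langle>x, e\<^sub>k\<rangle> e\<^sub>k\<close> and \<open>A\<^sub>n = P\<^sub>n \<cdots> P\<^sub>0\<close>, the map which sends a vector to its residual after
  \<open>n + 1\<close> steps of the Kaczmarz algorithm. Expanding the adjoint \<open>A\<^sub>n\<^sup>* = P\<^sub>0 \<cdots> P\<^sub>n\<close> turns the recursion
  for \<open>g\<close> into \<open>g\<^sub>n\<^sub>+\<^sub>1 = A\<^sub>n\<^sup>* e\<^sub>n\<^sub>+\<^sub>1\<close>, so the task is to solve this equation for \<open>e\<^sub>n\<^sub>+\<^sub>1\<close>, one \<open>n\<close> at a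
  time.

  Each step preserves \<open>\<parallel>A\<^sub>n x\<parallel>\<^sup>2 + (\<Sum>i\<le>n. \<bar>\<langle>x, g\<^sub>i\<rangle>\<bar>\<^sup>2) = \<parallel>x\<parallel>\<^sup>2\<close>. Hence a vector in the kernel of \<open>A\<^sub>n\<close>
  has exhausted the Bessel bound and is orthogonal to all later \<open>g\<^sub>k\<close>; stability of \<open>g\<close> then leaves
  only the multiples of \<open>e\<^sub>0\<close> (\<open>kernel_residual\<close>). Inductively this forces consecutive \<open>e\<^sub>n\<close>, \<open>e\<^sub>n\<^sub>+\<^sub>1\<close> to be
  non-orthogonal, which in turn determines all the spaces involved: \<open>A\<^sub>n\<close> has range \<open>e\<^sub>n\<^sup>\<bottom>\<close>
  (\<open>range_residual\<close>), \<open>A\<^sub>n\<^sup>*\<close> has kernel spanned by \<open>e\<^sub>n\<close> (\<open>kernel_residual_adj\<close>), and \<open>A\<^sub>n\<^sup>*\<close> has range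
  \<open>e\<^sub>0\<^sup>\<bottom>\<close>, with solutions bounded by the right-hand side (\<open>residual_adj_open\<close>).

  Since \<open>g\<^sub>n\<^sub>+\<^sub>1\<close> is orthogonal to \<open>g\<^sub>0 = e\<^sub>0\<close>, the equation is solvable and its solutions form a line
  \<open>u + \<complex> e\<^sub>n\<close> with \<open>u\<close> orthogonal to \<open>e\<^sub>n\<close>. The Bessel inequality gives \<open>\<parallel>u\<parallel> \<le> 1\<close>, so this line
  contains unit vectors, and the requirement \<open>\<langle>e\<^sub>n, e\<^sub>n\<^sub>+\<^sub>1\<rangle> \<ge> 0\<close> selects exactly one:
  \<open>u + sqrt (1 - \<parallel>u\<parallel>\<^sup>2) e\<^sub>n\<close>.

  For stability of \<open>e\<close>, every \<open>g\<^sub>n\<close> with \<open>n > N\<close> is the image under \<open>A\<^sub>N\<^sup>*\<close> of a vector in the span of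
  \<open>{e\<^sub>k | k \<ge> N}\<close>. These \<open>g\<^sub>n\<close> are linearly dense in \<open>e\<^sub>0\<^sup>\<bottom>\<close>, and density can be pulled back along
  \<open>A\<^sub>N\<^sup>*\<close>, because it is open onto \<open>e\<^sub>0\<^sup>\<bottom>\<close> and its kernel lies in the span of \<open>e\<^sub>N\<close>.
\<close>

section \<open>Complex inner products\<close>

lemma cinner_add_right: "cinner x (y + z) = cinner x y + cinner x z"
  by (metis cinner_add_left cinner_commute complex_cnj_add)

lemma cinner_scaleC_right: "cinner x (a *\<^sub>C y) = cnj a * cinner x y"
  by (metis cinner_scaleC_left cinner_commute complex_cnj_mult)

lemma cinner_zero_left [simp]: "cinner 0 y = 0"
  using cinner_scaleC_left[of 0 0 y] by simp

lemma cinner_zero_right [simp]: "cinner y 0 = 0"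
  using cinner_scaleC_right[of y 0 0] by simp

lemma cinner_diff_left: "cinner (x - y) z = cinner x z - cinner y z"
  using cinner_add_left[of "x - y" y z] by simp

lemma cinner_diff_right: "cinner z (x - y) = cinner z x - cinner z y"
  using cinner_add_right[of z "x - y" y] by simp

lemma cinner_self: "cinner x x = complex_of_real ((norm x)\<^sup>2)"
proof -
  have "Im (cinner x x) = 0"
    using cinner_commute[of x x] by (metis Im_complex_of_real Reals_cnj_iff complex_is_Real_iff)
  then show ?thesis
    by (simp add: complex_eq_iff norm_eq_sqrt_cinner cinner_ge_zero)
qed

lemma cinner_unit: "norm u = 1 \<Longrightarrow> cinner u u = 1"
  by (simp add: cinner_self)

lemma cinner_eq_zero_commute: "cinner x y = 0 \<longleftrightarrow> cinner y x = 0"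
  by (metis cinner_commute complex_cnj_zero_iff)

lemma norm_scaleC: "norm (a *\<^sub>C x) = cmod a * norm x"
proof -
  have "complex_of_real ((norm (a *\<^sub>C x))\<^sup>2) = a * cnj a * complex_of_real ((norm x)\<^sup>2)"
    by (simp only: cinner_self[symmetric]) (simp add: cinner_scaleC_left cinner_scaleC_right)
  also have "\<dots> = complex_of_real ((cmod a * norm x)\<^sup>2)"
    by (simp add: power_mult_distrib flip: complex_norm_square)
  finally have "(norm (a *\<^sub>C x))\<^sup>2 = (cmod a * norm x)\<^sup>2"
    by (simp only: of_real_eq_iff)
  then show ?thesis
    by (simp add: power2_eq_iff_nonneg)
qed

lemma Pythagoras:
  assumes "cinner x y = 0"
  shows "(norm (x + y))\<^sup>2 = (norm x)\<^sup>2 + (norm y)\<^sup>2"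
proof -
  have "complex_of_real ((norm (x + y))\<^sup>2) = complex_of_real ((norm x)\<^sup>2 + (norm y)\<^sup>2)"
    using assms cinner_eq_zero_commute[of x y]
    by (simp only: cinner_self[symmetric] of_real_add)
      (simp add: cinner_add_left cinner_add_right)
  then show ?thesis
    by (simp only: of_real_eq_iff)
qed

lemma norm_le_norm_add_orthogonal:
  assumes "cinner x y = 0"
  shows "norm x \<le> norm (x + y)"
  using Pythagoras[OF assms] by (simp add: power2_le_imp_le)

lemma orthogonal_span:
  assumes "\<And>s. s \<in> S \<Longrightarrow> cinner x s = 0" and "p \<in> complex_vector.span S"
  shows "cinner x p = 0"
  using assms(2)
  by (induction rule: complex_vector.span_induct_alt)
    (simp_all add: assms(1) cinner_add_right cinner_scaleC_right)

lemma linearly_dense_approx: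
  assumes "linearly_dense S" and "0 < \<epsilon>"
  obtains p where "p \<in> complex_vector.span S" and "norm (x - p) < \<epsilon>"
  using assms unfolding linearly_dense_def
  by (metis UNIV_I closure_approachable dist_norm norm_minus_commute)

text \<open>
  An approximant \<open>p\<close> of \<open>x\<close> in the span is orthogonal to \<open>x\<close>, so by Pythagoras its distance from \<open>x\<close>
  is at least the norm of \<open>x\<close>.
\<close>

lemma orthogonal_linearly_dense_eq_zero:
  assumes "linearly_dense S" and "\<And>s. s \<in> S \<Longrightarrow> cinner x s = 0"
  shows "x = 0"
proof (rule ccontr)
  assume "x \<noteq> 0"
  then obtain p where p: "p \<in> complex_vector.span S" "norm (x - p) < norm x"
    using linearly_dense_approx[OF assms(1), of "norm x"] by auto
  have "cinner x (- p) = 0"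
    using orthogonal_span[OF assms(2) p(1)] cinner_diff_right[of x 0 p] by simp
  from norm_le_norm_add_orthogonal[OF this] p(2) show False
    by simp
qed

section \<open>Projecting away unit vectors one after another\<close>

definition project_away :: "'a::complex_inner \<Rightarrow> 'a \<Rightarrow> 'a"
  where "project_away u x = x - cinner x u *\<^sub>C u"

text \<open>
  \<open>residual e n\<close> is \<open>A\<^sub>n = P\<^sub>n \<cdots> P\<^sub>0\<close>, and \<open>residual_adj e n\<close> is its adjoint \<open>P\<^sub>0 \<cdots> P\<^sub>n\<close>. Both are
  defined for arbitrary \<open>e\<close>, although \<open>P\<^sub>k\<close> is a projection only if \<open>e\<^sub>k\<close> is a unit vector (or zero).
\<close>

fun residual :: "(nat \<Rightarrow> 'a::complex_inner) \<Rightarrow> nat \<Rightarrow> 'a \<Rightarrow> 'a" where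
  "residual e 0 x = project_away (e 0) x"
| "residual e (Suc n) x = project_away (e (Suc n)) (residual e n x)"

fun residual_adj :: "(nat \<Rightarrow> 'a::complex_inner) \<Rightarrow> nat \<Rightarrow> 'a \<Rightarrow> 'a" where
  "residual_adj e 0 y = project_away (e 0) y"
| "residual_adj e (Suc n) y = residual_adj e n (project_away (e (Suc n)) y)"

lemma project_away_add: "project_away u (x + y) = project_away u x + project_away u y"
  by (simp add: project_away_def cinner_add_left scaleC_add_left)

lemma project_away_scaleC: "project_away u (a *\<^sub>C x) = a *\<^sub>C project_away u x"
  by (simp add: project_away_def cinner_scaleC_left complex_vector.scale_right_diff_distrib)

lemma project_away_self: "norm u = 1 \<Longrightarrow> project_away u u = 0"
  by (simp add: project_away_def cinner_unit)

lemma project_away_zero [simp]: "project_away u 0 = 0"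
  by (simp add: project_away_def)

lemma project_away_orthogonal: "cinner x u = 0 \<Longrightarrow> project_away u x = x"
  by (simp add: project_away_def)

lemma cinner_project_away:
  "norm u = 1 \<Longrightarrow> cinner (project_away u x) u = 0"
  by (simp add: project_away_def cinner_diff_left cinner_scaleC_left cinner_unit)

lemma project_away_self_adjoint:
  "cinner (project_away u x) y = cinner x (project_away u y)"
  using cinner_commute[of u y]
  by (simp add: project_away_def cinner_diff_left cinner_diff_right
      cinner_scaleC_left cinner_scaleC_right)

lemma norm_project_away:
  assumes "norm u = 1"
  shows "(norm (project_away u x))\<^sup>2 + (cmod (cinner x u))\<^sup>2 = (norm x)\<^sup>2"
proof -
  have "cinner (project_away u x) (cinner x u *\<^sub>C u) = 0"
    by (simp add: cinner_scaleC_right cinner_project_away assms)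
  from Pythagoras[OF this] show ?thesis
    by (simp add: project_away_def norm_scaleC assms)
qed

lemma cmod_cinner_unit_le:
  assumes "norm u = 1"
  shows "cmod (cinner x u) \<le> norm x"
  using norm_project_away[OF assms, of x]
  by (metis le_add_same_cancel2 norm_ge_zero power2_le_imp_le zero_le_power2)

lemma residual_add: "residual e n (x + y) = residual e n x + residual e n y"
  by (induction n) (simp_all add: project_away_add)

lemma residual_scaleC: "residual e n (a *\<^sub>C x) = a *\<^sub>C residual e n x"
  by (induction n) (simp_all add: project_away_scaleC)

lemma residual_diff: "residual e n (x - y) = residual e n x - residual e n y"
  using residual_add[of e n "x - y" y] by simp

lemma residual_adj_add:
  "residual_adj e n (x + y) = residual_adj e n x + residual_adj e n y"
  by (induction n arbitrary: x y) (simp_all add: project_away_add)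

lemma residual_adj_scaleC: "residual_adj e n (a *\<^sub>C x) = a *\<^sub>C residual_adj e n x"
  by (induction n arbitrary: x) (simp_all add: project_away_scaleC)

lemma residual_adj_diff:
  "residual_adj e n (x - y) = residual_adj e n x - residual_adj e n y"
  using residual_adj_add[of e n "x - y" y] by simp

lemma residual_adj_zero [simp]: "residual_adj e n 0 = 0"
  using residual_adj_diff[of e n 0 0] by simp

lemma residual_adj_cong:
  "(\<And>i. i \<le> n \<Longrightarrow> e i = f i) \<Longrightarrow> residual_adj e n y = residual_adj f n y"
  by (induction n arbitrary: y) simp_all

lemma cinner_residual: "cinner (residual e n x) y = cinner x (residual_adj e n y)"
  by (induction n arbitrary: y) (simp_all add: project_away_self_adjoint)

lemma residual_first:
  assumes "norm (e 0) = 1"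
  shows "residual e n (e 0) = 0"
  by (induction n) (simp_all add: assms project_away_self)

lemma residual_adj_last:
  assumes "norm (e n) = 1"
  shows "residual_adj e n (e n) = 0"
  using assms by (cases n) (simp_all add: project_away_self)

text \<open>
  In \<open>A\<^sub>n\<^sub>+\<^sub>1\<^sup>* y = A\<^sub>n\<^sup>* (y - \<langle>y, e\<^sub>n\<^sub>+\<^sub>1\<rangle> e\<^sub>n\<^sub>+\<^sub>1)\<close> the subtracted vector contributes a multiple of
  \<open>A\<^sub>n\<^sup>* e\<^sub>n\<^sub>+\<^sub>1 = g\<^sub>n\<^sub>+\<^sub>1\<close>, that is, one more term of the sum.
\<close>

lemma residual_adj_eq_sum:
  assumes "g 0 = e 0" and "\<And>k. k < n \<Longrightarrow> g (Suc k) = residual_adj e k (e (Suc k))"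
  shows "residual_adj e n y = y - (\<Sum>i\<le>n. cinner y (e i) *\<^sub>C g i)"
  using assms(2)
proof (induction n)
  case 0
  then show ?case
    by (simp add: project_away_def assms(1))
next
  case (Suc n)
  then show ?case
    by (simp add: project_away_def[of "e (Suc n)"] residual_adj_diff residual_adj_scaleC)
qed

lemma generates_iff_residual_adj:
  "generates e g \<longleftrightarrow> g 0 = e 0 \<and> (\<forall>k. g (Suc k) = residual_adj e k (e (Suc k)))"
proof
  assume gen: "generates e g"
  have "g (Suc k) = residual_adj e k (e (Suc k))" for k
  proof (induction k rule: less_induct)
    case (less k)
    then show ?case
      using gen residual_adj_eq_sum[of g e k "e (Suc k)"]
      by (simp add: generates_def lessThan_Suc_atMost)
  qed
  then show "g 0 = e 0 \<and> (\<forall>k. g (Suc k) = residual_adj e k (e (Suc k)))"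
    using gen by (simp add: generates_def)
next
  assume R: "g 0 = e 0 \<and> (\<forall>k. g (Suc k) = residual_adj e k (e (Suc k)))"
  have "g n = e n - (\<Sum>i<n. cinner (e n) (e i) *\<^sub>C g i)" if "n \<ge> 1" for n
  proof -
    from that obtain k where "n = Suc k"
      by (cases n) auto
    then show ?thesis
      using R residual_adj_eq_sum[of g e k "e (Suc k)"] by (simp add: lessThan_Suc_atMost)
  qed
  then show "generates e g"
    using R by (simp add: generates_def)
qed

section \<open>Stable Bessel sequences\<close>

lemma Bessel_sum_le:
  assumes "normalized_Bessel g" and "finite I"
  shows "(\<Sum>i\<in>I. (cmod (cinner x (g i)))\<^sup>2) \<le> (norm x)\<^sup>2"
proof -
  have "(\<Sum>i\<in>I. (cmod (cinner x (g i)))\<^sup>2) \<le> (\<Sum>i. (cmod (cinner x (g i)))\<^sup>2)"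
    using assms by (intro sum_le_suminf) (auto simp: normalized_Bessel_def)
  with assms(1) show ?thesis
    unfolding normalized_Bessel_def by (meson order_trans)
qed

lemma Bessel_orthogonal_if_exhausted:
  assumes "normalized_Bessel g" and "(\<Sum>i\<le>n. (cmod (cinner x (g i)))\<^sup>2) = (norm x)\<^sup>2" and "n < k"
  shows "cinner x (g k) = 0"
proof -
  have "(\<Sum>i\<in>insert k {..n}. (cmod (cinner x (g i)))\<^sup>2) \<le> (norm x)\<^sup>2"
    by (rule Bessel_sum_le[OF assms(1)]) simp
  with assms(2,3) show ?thesis
    by simp
qed

lemma Bessel_first_orthogonal:
  assumes "normalized_Bessel g" and "0 < k"
  shows "cinner (g 0) (g k) = 0"
proof (rule Bessel_orthogonal_if_exhausted[OF assms(1) _ assms(2)])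
  show "(\<Sum>i\<le>0. (cmod (cinner (g 0) (g i)))\<^sup>2) = (norm (g 0))\<^sup>2"
    using assms(1) by (simp add: normalized_Bessel_def cinner_unit)
qed

text \<open>
  This is the only form in which stability of \<open>g\<close> enters the analysis of the maps \<open>A\<^sub>n\<close>.
\<close>

lemma stable_orthogonal_tail:
  assumes "stable_normalized_Bessel g" and "\<And>k. n < k \<Longrightarrow> cinner x (g k) = 0"
    and "cinner x (g 0) = 0"
  shows "x = 0"
proof (rule orthogonal_linearly_dense_eq_zero)
  show "linearly_dense ({g 0} \<union> g ` {Suc n..})"
    using assms(1) by (simp add: stable_normalized_Bessel_def)
  show "cinner x s = 0" if "s \<in> {g 0} \<union> g ` {Suc n..}" for s
    using that assms(2,3) by auto
qed

section \<open>The recursion for the unit vectors\<close>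

definition next_vector :: "(nat \<Rightarrow> 'a::complex_inner) \<Rightarrow> (nat \<Rightarrow> 'a) \<Rightarrow> nat \<Rightarrow> 'a \<Rightarrow> bool"
  where "next_vector g e n r \<longleftrightarrow>
    norm r = 1 \<and> cinner (e n) r \<in> \<real>\<^sub>\<ge>\<^sub>0 \<and> residual_adj e n r = g (Suc n)"

text \<open>
  The facts needed to construct \<open>e\<^sub>n\<^sub>+\<^sub>1\<close> concern only \<open>e\<^sub>0, \<dots>, e\<^sub>n\<close>, so they are proved for sequences that
  satisfy the recursion on an initial segment and are arbitrary afterwards.
\<close>

definition solves_upto :: "(nat \<Rightarrow> 'a::complex_inner) \<Rightarrow> (nat \<Rightarrow> 'a) \<Rightarrow> nat \<Rightarrow> bool"
  where "solves_upto g e n \<longleftrightarrow> e 0 = g 0 \<and> (\<forall>k<n. next_vector g e k (e (Suc k)))"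

lemma solves_upto_Suc:
  "solves_upto g e (Suc n) \<longleftrightarrow> solves_upto g e n \<and> next_vector g e n (e (Suc n))"
  by (auto simp: solves_upto_def less_Suc_eq)

lemma next_vector_cong:
  "(\<And>i. i \<le> n \<Longrightarrow> e i = f i) \<Longrightarrow> next_vector g e n r = next_vector g f n r"
  using residual_adj_cong[of n e f r] by (simp add: next_vector_def)

lemma admissible_generates_iff_solves:
  assumes "norm (g 0) = 1"
  shows "admissible_unit_sequence e \<and> generates e g \<longleftrightarrow> (\<forall>n. solves_upto g e n)"
proof
  assume "admissible_unit_sequence e \<and> generates e g"
  then show "\<forall>n. solves_upto g e n"
    by (simp add: solves_upto_def next_vector_def generates_iff_residual_adj
        admissible_unit_sequence_def unit_sequence_def)
next
  assume "\<forall>n. solves_upto g e n"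
  then have first: "e 0 = g 0" and step: "\<And>k. next_vector g e k (e (Suc k))"
    by (auto simp: solves_upto_def)
  have "norm (e n) = 1" for n
    using step assms first by (cases n) (auto simp: next_vector_def)
  with first step show "admissible_unit_sequence e \<and> generates e g"
    by (simp add: next_vector_def generates_iff_residual_adj
        admissible_unit_sequence_def unit_sequence_def)
qed

context
  fixes g :: "nat \<Rightarrow> 'a::complex_inner"
  assumes stable: "stable_normalized_Bessel g"
begin

lemma Bessel: "normalized_Bessel g" and norm_first: "norm (g 0) = 1"
  using stable by (simp_all add: stable_normalized_Bessel_def normalized_Bessel_def)

lemma solves_norm:
  assumes "solves_upto g e n" and "k \<le> n"
  shows "norm (e k) = 1"
  using assms norm_first by (cases k) (auto simp: solves_upto_def next_vector_def)

text \<open>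
  Projecting \<open>e\<^sub>n\<^sub>+\<^sub>1\<close> away from \<open>A\<^sub>n x\<close> lowers the squared norm by \<open>\<bar>\<langle>A\<^sub>n x, e\<^sub>n\<^sub>+\<^sub>1\<rangle>\<bar>\<^sup>2\<close>, and this
  inner product equals \<open>\<langle>x, A\<^sub>n\<^sup>* e\<^sub>n\<^sub>+\<^sub>1\<rangle> = \<langle>x, g\<^sub>n\<^sub>+\<^sub>1\<rangle>\<close>.
\<close>

lemma residual_Parseval:
  assumes "solves_upto g e n"
  shows "(norm (residual e n x))\<^sup>2 + (\<Sum>i\<le>n. (cmod (cinner x (g i)))\<^sup>2) = (norm x)\<^sup>2"
  using assms
proof (induction n)
  case 0
  then show ?case
    using norm_project_away[of "g 0" x] norm_first by (simp add: solves_upto_def)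
next
  case (Suc n)
  have "cinner (residual e n x) (e (Suc n)) = cinner x (g (Suc n))"
    using Suc.prems by (simp add: solves_upto_Suc next_vector_def cinner_residual)
  then show ?case
    using Suc norm_project_away[of "e (Suc n)" "residual e n x"]
    by (simp add: solves_upto_Suc next_vector_def)
qed

text \<open>
  The component \<open>y\<close> of \<open>x\<close> orthogonal to \<open>e\<^sub>0\<close> is also in the kernel. By the norm identity it exhausts
  the Bessel bound within the first \<open>n + 1\<close> terms, hence is orthogonal to \<open>g\<^sub>0\<close> and to all later \<open>g\<^sub>k\<close>.
\<close>

lemma kernel_residual:
  assumes "solves_upto g e n" and "residual e n x = 0"
  shows "x = cinner x (e 0) *\<^sub>C e 0"
proof -
  define y where "y = project_away (e 0) x"
  have first: "e 0 = g 0" "norm (e 0) = 1"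
    using assms(1) norm_first by (simp_all add: solves_upto_def)
  have "residual e n y = 0"
    using assms(2) first(2)
    by (simp add: y_def project_away_def residual_diff residual_scaleC residual_first)
  then have "(\<Sum>i\<le>n. (cmod (cinner y (g i)))\<^sup>2) = (norm y)\<^sup>2"
    using residual_Parseval[OF assms(1), of y] by simp
  then have "cinner y (g k) = 0" if "n < k" for k
    using Bessel_orthogonal_if_exhausted[OF Bessel _ that] by blast
  moreover have "cinner y (g 0) = 0"
    using cinner_project_away[OF first(2)] first(1) by (simp add: y_def)
  ultimately have "y = 0"
    using stable_orthogonal_tail[OF stable] by blast
  then show ?thesis
    by (simp add: y_def project_away_def)
qed

text \<open>
  If \<open>e\<^sub>n\<^sub>+\<^sub>1\<close> were orthogonal to \<open>e\<^sub>n\<close>, it would be some \<open>A\<^sub>n x\<close>. Then \<open>A\<^sub>n\<^sub>+\<^sub>1 x = 0\<close>, so \<open>x\<close> is a multiple of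
  \<open>e\<^sub>0\<close>; but \<open>A\<^sub>n\<close> kills \<open>e\<^sub>0\<close> already. The range hypothesis is discharged later: it and
  non-orthogonality are proved in one induction.
\<close>

lemma consecutive_not_orthogonal_if_range:
  assumes solves: "solves_upto g e (Suc n)"
    and range: "\<And>y. cinner y (e n) = 0 \<Longrightarrow> \<exists>x. residual e n x = y"
  shows "cinner (e (Suc n)) (e n) \<noteq> 0"
proof
  assume "cinner (e (Suc n)) (e n) = 0"
  then obtain x where x: "residual e n x = e (Suc n)"
    using range by blast
  have units: "norm (e (Suc n)) = 1" "norm (e 0) = 1"
    using solves by (auto intro: solves_norm)
  from x units(1) have "residual e (Suc n) x = 0"
    by (simp add: project_away_self)
  with solves have "x = cinner x (e 0) *\<^sub>C e 0"
    by (rule kernel_residual)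
  then have "residual e n x = 0"
    using residual_scaleC[of e n "cinner x (e 0)" "e 0"] residual_first[of e n] units(2)
    by simp
  with x units(1) show False
    by simp
qed

text \<open>
  Given \<open>y\<close> orthogonal to \<open>e\<^sub>n\<^sub>+\<^sub>1\<close>, subtract the multiple of \<open>e\<^sub>n\<^sub>+\<^sub>1\<close> that makes the difference orthogonal to
  \<open>e\<^sub>n\<close>; this is possible because \<open>e\<^sub>n\<close> and \<open>e\<^sub>n\<^sub>+\<^sub>1\<close> are not orthogonal. The difference is in the range of
  \<open>A\<^sub>n\<close> by induction, and \<open>P\<^sub>n\<^sub>+\<^sub>1\<close> undoes the change.
\<close>

lemma range_residual:
  assumes "solves_upto g e n" and "cinner y (e n) = 0"
  shows "\<exists>x. residual e n x = y"
  using assms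
proof (induction n arbitrary: y)
  case 0
  then show ?case
    by (auto intro: exI[of _ y] simp: project_away_orthogonal)
next
  case (Suc n)
  have solves: "solves_upto g e n"
    using Suc.prems(1) by (simp add: solves_upto_Suc)
  have nonorth: "cinner (e (Suc n)) (e n) \<noteq> 0"
    using Suc.prems(1) Suc.IH[OF solves] by (rule consecutive_not_orthogonal_if_range)
  define z where "z = y - (cinner y (e n) / cinner (e (Suc n)) (e n)) *\<^sub>C e (Suc n)"
  have "cinner z (e n) = 0"
    using nonorth by (simp add: z_def cinner_diff_left cinner_scaleC_left)
  then obtain x where "residual e n x = z"
    using Suc.IH[OF solves] by blast
  moreover have "project_away (e (Suc n)) z = y"
    using Suc.prems(2) solves_norm[OF Suc.prems(1), of "Suc n"]
    by (simp add: z_def project_away_def cinner_diff_left cinner_scaleC_left cinner_unit)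
  ultimately show ?case
    by auto
qed

lemma consecutive_not_orthogonal:
  assumes "solves_upto g e (Suc n)"
  shows "cinner (e (Suc n)) (e n) \<noteq> 0" and "cinner (e n) (e (Suc n)) \<noteq> 0"
proof -
  show "cinner (e (Suc n)) (e n) \<noteq> 0"
    by (rule consecutive_not_orthogonal_if_range[OF assms], rule range_residual)
      (use assms in \<open>simp_all add: solves_upto_Suc\<close>)
  then show "cinner (e n) (e (Suc n)) \<noteq> 0"
    by (simp add: cinner_eq_zero_commute)
qed

text \<open>
  If \<open>A\<^sub>n\<^sub>+\<^sub>1\<^sup>* y = 0\<close>, then by induction \<open>z = P\<^sub>n\<^sub>+\<^sub>1 y\<close> is a multiple of \<open>e\<^sub>n\<close>. It is also orthogonal to
  \<open>e\<^sub>n\<^sub>+\<^sub>1\<close>, while \<open>e\<^sub>n\<close> is not, so \<open>z\<close> vanishes. The conclusion says that \<open>y\<close> is a multiple of \<open>e\<^sub>n\<close>.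
\<close>

lemma kernel_residual_adj:
  assumes "solves_upto g e n" and "residual_adj e n y = 0"
  shows "project_away (e n) y = 0"
  using assms
proof (induction n arbitrary: y)
  case (Suc n)
  define z where "z = project_away (e (Suc n)) y"
  have "project_away (e n) z = 0"
    using Suc by (simp add: solves_upto_Suc z_def)
  then have z: "z = cinner z (e n) *\<^sub>C e n"
    by (simp add: project_away_def)
  have "cinner z (e n) * cinner (e n) (e (Suc n)) = cinner (cinner z (e n) *\<^sub>C e n) (e (Suc n))"
    by (simp only: cinner_scaleC_left)
  also have "\<dots> = cinner z (e (Suc n))"
    by (simp only: z[symmetric])
  also have "\<dots> = 0"
    using solves_norm[OF Suc.prems(1), of "Suc n"] by (simp add: z_def cinner_project_away)
  finally have "cinner z (e n) * cinner (e n) (e (Suc n)) = 0" .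
  then have "cinner z (e n) = 0"
    using consecutive_not_orthogonal[OF Suc.prems(1)] by simp
  then have "cinner z (e n) *\<^sub>C e n = 0"
    by simp
  with z have "z = 0"
    by (rule trans)
  then show ?case
    by (simp add: z_def)
qed simp

text \<open>
  A solution \<open>y\<close> of \<open>A\<^sub>n\<^sup>* y = w\<close> stays a solution when a multiple of \<open>e\<^sub>n\<close> is added. A suitable multiple
  makes it orthogonal to \<open>e\<^sub>n\<^sub>+\<^sub>1\<close>, so that it is fixed by \<open>P\<^sub>n\<^sub>+\<^sub>1\<close> and solves \<open>A\<^sub>n\<^sub>+\<^sub>1\<^sup>* y = w\<close> as well. This
  multiplies the bound by at most \<open>1 + 1 / \<bar>\<langle>e\<^sub>n, e\<^sub>n\<^sub>+\<^sub>1\<rangle>\<bar>\<close>. The bound is what makes density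
  pull back along \<open>A\<^sub>n\<^sup>*\<close>.
\<close>

lemma residual_adj_open:
  assumes "solves_upto g e n"
  shows "\<exists>C>0. \<forall>w. cinner w (e 0) = 0 \<longrightarrow> (\<exists>y. residual_adj e n y = w \<and> norm y \<le> C * norm w)"
  using assms
proof (induction n)
  case 0
  have "residual_adj e 0 w = w \<and> norm w \<le> 1 * norm w" if "cinner w (e 0) = 0" for w
    using that by (simp add: project_away_orthogonal)
  then show ?case
    using zero_less_one by blast
next
  case (Suc n)
  then obtain C where C: "0 < C"
    "\<And>w. cinner w (e 0) = 0 \<Longrightarrow> \<exists>y. residual_adj e n y = w \<and> norm y \<le> C * norm w"
    by (auto simp: solves_upto_Suc)
  define d where "d = cinner (e n) (e (Suc n))"
  have d: "d \<noteq> 0"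
    using consecutive_not_orthogonal[OF Suc.prems] by (simp add: d_def)
  have units: "norm (e n) = 1" "norm (e (Suc n)) = 1"
    using solves_norm[OF Suc.prems] by simp_all
  show ?case
  proof (intro exI[of _ "(1 + 1 / cmod d) * C"] conjI allI impI)
    show "0 < (1 + 1 / cmod d) * C"
      using C(1) by (simp add: add_pos_nonneg)
  next
    fix w
    assume "cinner w (e 0) = 0"
    then obtain y where y: "residual_adj e n y = w" "norm y \<le> C * norm w"
      using C(2) by blast
    define a where "a = cinner y (e (Suc n)) / d"
    have "cinner (y - a *\<^sub>C e n) (e (Suc n)) = 0"
      using d by (simp add: a_def d_def cinner_diff_left cinner_scaleC_left)
    then have "residual_adj e (Suc n) (y - a *\<^sub>C e n) = residual_adj e n (y - a *\<^sub>C e n)"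
      by (simp only: residual_adj.simps project_away_orthogonal)
    also have "\<dots> = w"
      using y(1) units(1) by (simp add: residual_adj_diff residual_adj_scaleC residual_adj_last)
    finally have "residual_adj e (Suc n) (y - a *\<^sub>C e n) = w" .
    moreover have "norm (y - a *\<^sub>C e n) \<le> (1 + 1 / cmod d) * C * norm w"
    proof -
      have "norm (y - a *\<^sub>C e n) \<le> norm y + cmod a"
        using norm_triangle_ineq4[of y "a *\<^sub>C e n"] units(1) by (simp add: norm_scaleC)
      also have "\<dots> \<le> norm y + norm y / cmod d"
        using cmod_cinner_unit_le[OF units(2), of y]
        by (simp add: a_def norm_divide divide_right_mono)
      also have "\<dots> = (1 + 1 / cmod d) * norm y"
        by (simp add: algebra_simps)
      also have "\<dots> \<le> (1 + 1 / cmod d) * (C * norm w)"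
        using y(2) by (intro mult_left_mono) auto
      finally show ?thesis
        by (simp add: mult.assoc)
    qed
    ultimately show "\<exists>y. residual_adj e (Suc n) y = w \<and> norm y \<le> (1 + 1 / cmod d) * C * norm w"
      by blast
  qed
qed

text \<open>
  Write \<open>u = A\<^sub>n x\<close>. Then \<open>\<parallel>u\<parallel>\<^sup>2 = \<langle>A\<^sub>n x, u\<rangle> = \<langle>x, g\<^sub>n\<^sub>+\<^sub>1\<rangle>\<close>, while the Bessel inequality for one more
  term and the norm identity give \<open>\<bar>\<langle>x, g\<^sub>n\<^sub>+\<^sub>1\<rangle>\<bar> \<le> \<parallel>A\<^sub>n x\<parallel> = \<parallel>u\<parallel>\<close>.
\<close>

lemma norm_minimal_solution_le_one:
  assumes "solves_upto g e n" and "cinner u (e n) = 0" and "residual_adj e n u = g (Suc n)"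
  shows "norm u \<le> 1"
proof -
  obtain x where x: "residual e n x = u"
    using range_residual[OF assms(1,2)] by blast
  have "(\<Sum>i\<le>Suc n. (cmod (cinner x (g i)))\<^sup>2) \<le> (norm x)\<^sup>2"
    by (rule Bessel_sum_le[OF Bessel]) simp
  then have "(cmod (cinner x (g (Suc n))))\<^sup>2 \<le> (norm u)\<^sup>2"
    using residual_Parseval[OF assms(1), of x] unfolding x sum.atMost_Suc by linarith
  moreover have "cinner x (g (Suc n)) = complex_of_real ((norm u)\<^sup>2)"
    using cinner_residual[of e n x u] x assms(3) by (simp add: cinner_self)
  ultimately have "(norm u)\<^sup>2 \<le> norm u"
    by (simp add: norm_power power2_le_imp_le)
  then show ?thesis
    using mult_strict_left_mono[of 1 "norm u" "norm u"]
    unfolding power2_eq_square by (smt (verit))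
qed

lemma next_vector_exists:
  assumes solves: "solves_upto g e n"
  shows "\<exists>r. next_vector g e n r"
proof -
  have unit: "norm (e n) = 1"
    by (rule solves_norm[OF solves]) simp
  have "cinner (g (Suc n)) (e 0) = 0"
    using Bessel_first_orthogonal[OF Bessel, of "Suc n"] solves
    by (simp add: solves_upto_def cinner_eq_zero_commute)
  then obtain y where y: "residual_adj e n y = g (Suc n)"
    using residual_adj_open[OF solves] by blast
  define u where "u = project_away (e n) y"
  have u: "cinner u (e n) = 0" "residual_adj e n u = g (Suc n)"
    using unit y by (simp_all add: u_def cinner_project_away)
      (simp add: project_away_def residual_adj_diff residual_adj_scaleC residual_adj_last)
  define c where "c = sqrt (1 - (norm u)\<^sup>2)"
  have c: "0 \<le> c" "c\<^sup>2 = 1 - (norm u)\<^sup>2"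
    using norm_minimal_solution_le_one[OF solves u] by (simp_all add: c_def power_le_one)
  define r where "r = u + complex_of_real c *\<^sub>C e n"
  have "(norm r)\<^sup>2 = 1"
    using Pythagoras[of u "complex_of_real c *\<^sub>C e n"] u(1) c unit
    by (simp add: r_def cinner_scaleC_right norm_scaleC)
  then have "norm r = 1"
    by (simp add: power2_eq_1_iff) (smt (verit) norm_ge_zero)
  moreover have "cinner (e n) r = complex_of_real c"
    using u(1) unit cinner_eq_zero_commute[of u "e n"]
    by (simp add: r_def cinner_add_right cinner_scaleC_right cinner_unit)
  moreover have "residual_adj e n r = g (Suc n)"
    using u(2) unit
    by (simp add: r_def residual_adj_add residual_adj_scaleC residual_adj_last)
  ultimately have "next_vector g e n r"
    using c(1) by (simp add: next_vector_def)
  then show ?thesis ..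
qed

text \<open>
  Two candidates have the same component orthogonal to \<open>e\<^sub>n\<close>. The remaining coefficient is a
  nonnegative real, hence determined by the norm being 1.
\<close>

lemma next_vector_unique:
  assumes solves: "solves_upto g e n" and r: "next_vector g e n r" and s: "next_vector g e n s"
  shows "r = s"
proof -
  have unit: "norm (e n) = 1"
    by (rule solves_norm[OF solves]) simp
  have coeff: "cinner t (e n) = complex_of_real (sqrt (1 - (norm (project_away (e n) t))\<^sup>2))"
    if t: "next_vector g e n t" for t
  proof -
    obtain c where c: "0 \<le> c" "cinner (e n) t = complex_of_real c"
      using t by (auto simp: next_vector_def elim: nonneg_Reals_cases)
    then have inner: "cinner t (e n) = complex_of_real c"
      by (metis cinner_commute complex_cnj_complex_of_real)
    then have "c\<^sup>2 = 1 - (norm (project_away (e n) t))\<^sup>2"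
      using norm_project_away[OF unit, of t] t by (simp add: next_vector_def)
    then have "sqrt (1 - (norm (project_away (e n) t))\<^sup>2) = c"
      using c(1) by (rule real_sqrt_unique)
    then show ?thesis
      using inner by simp
  qed
  have "residual_adj e n (r - s) = 0"
    using r s by (simp add: next_vector_def residual_adj_diff)
  with solves have "project_away (e n) (r - s) = 0"
    by (rule kernel_residual_adj)
  then have same: "project_away (e n) r = project_away (e n) s"
    using project_away_add[of "e n" "r - s" s] by simp
  then have "cinner r (e n) = cinner s (e n)"
    using coeff[OF r] coeff[OF s] by simp
  with same show ?thesis
    by (simp add: project_away_def)
qed

lemma solution_exists: "\<exists>e. \<forall>n. solves_upto g e n"
proof -
  define P where "P e n r \<longleftrightarrow> (case n of 0 \<Rightarrow> r = g 0 | Suc k \<Rightarrow> next_vector g e k r)" for e n r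
  have "\<exists>e. \<forall>n. P e n (e n)"
  proof (rule dependent_wellorder_choice)
    fix r and e f :: "nat \<Rightarrow> 'a" and n :: nat
    assume "\<And>i. i < n \<Longrightarrow> e i = f i"
    then show "P e n r = P f n r"
      by (auto simp: P_def split: nat.split intro!: next_vector_cong)
  next
    fix n e
    assume P: "\<And>i. i < n \<Longrightarrow> P e i (e i)"
    show "\<exists>r. P e n r"
    proof (cases n)
      case (Suc k)
      have "solves_upto g e k"
        unfolding solves_upto_def
        using P[of 0] P[of "Suc i" for i] Suc by (auto simp: P_def)
      then show ?thesis
        using next_vector_exists Suc by (simp add: P_def)
    qed (simp add: P_def)
  qed
  then obtain e where P: "\<And>n. P e n (e n)"
    by blast
  have "solves_upto g e n" for n
    using P[of 0] P[of "Suc i" for i] by (simp add: P_def solves_upto_def)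
  then show ?thesis
    by blast
qed

lemma solution_unique:
  assumes e: "\<And>n. solves_upto g e n" and f: "\<And>n. solves_upto g f n"
  shows "e = f"
proof
  fix n
  show "e n = f n"
  proof (induction n rule: less_induct)
    case (less n)
    show ?case
    proof (cases n)
      case 0
      then show ?thesis
        using e[of 0] f[of 0] by (simp add: solves_upto_def)
    next
      case (Suc k)
      have "next_vector g f k (f n)" "next_vector g e k (e n)"
        using e[of n] f[of n] by (simp_all add: Suc solves_upto_Suc)
      moreover have "next_vector g f k (f n) = next_vector g e k (f n)"
        using less Suc by (intro next_vector_cong) auto
      ultimately show ?thesis
        using next_vector_unique[OF e[of k], of "e n" "f n"] by simp
    qed
  qed
qed

section \<open>Stability of the unit vectors\<close>

text \<open>
  \<open>A\<^sub>N\<^sub>+\<^sub>k\<^sup>* = A\<^sub>N\<^sup>* P\<^sub>N\<^sub>+\<^sub>1 \<cdots> P\<^sub>N\<^sub>+\<^sub>k\<close>, and the extra factors change a vector only by a combination of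
  \<open>e\<^sub>N\<^sub>+\<^sub>1, \<dots>, e\<^sub>N\<^sub>+\<^sub>k\<close>.
\<close>

lemma residual_adj_tail:
  "\<exists>s \<in> complex_vector.span (e ` {N..}). residual_adj e (N + k) y = residual_adj e N (y - s)"
proof (induction k arbitrary: y)
  case 0
  show ?case
    by (auto intro: bexI[of _ 0] simp: complex_vector.span_zero)
next
  case (Suc k)
  let ?v = "cinner y (e (Suc (N + k))) *\<^sub>C e (Suc (N + k))"
  obtain s where s: "s \<in> complex_vector.span (e ` {N..})"
    "residual_adj e (N + k) (y - ?v) = residual_adj e N (y - ?v - s)"
    using Suc.IH by blast
  have "?v \<in> complex_vector.span (e ` {N..})"
    by (intro complex_vector.span_scale complex_vector.span_base) auto
  then have "?v + s \<in> complex_vector.span (e ` {N..})"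
    using s(1) by (rule complex_vector.span_add)
  moreover have "residual_adj e (N + Suc k) y = residual_adj e N (y - (?v + s))"
    using s(2) by (simp add: project_away_def diff_diff_eq)
  ultimately show ?case
    by blast
qed

lemma span_tail_subset_image:
  assumes "\<And>n. solves_upto g e n" and "q \<in> complex_vector.span (g ` {Suc N..})"
  shows "q \<in> residual_adj e N ` complex_vector.span (e ` {N..})"
  using assms(2)
proof (induction rule: complex_vector.span_induct_alt)
  case base
  show ?case
    by (rule image_eqI[of _ _ 0]) (simp_all add: complex_vector.span_zero)
next
  case (step a x q)
  then obtain n where n: "Suc N \<le> n" "x = g n"
    by auto
  define k where "k = n - Suc N"
  have k: "x = g (Suc (N + k))"
    using n by (simp add: k_def)
  have "x = residual_adj e (N + k) (e (Suc (N + k)))"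
    using assms(1)[of "Suc (N + k)"] k by (simp add: solves_upto_Suc next_vector_def)
  then obtain s where s: "s \<in> complex_vector.span (e ` {N..})"
    "x = residual_adj e N (e (Suc (N + k)) - s)"
    using residual_adj_tail by metis
  obtain t where t: "t \<in> complex_vector.span (e ` {N..})" "q = residual_adj e N t"
    using step by blast
  have "e (Suc (N + k)) \<in> complex_vector.span (e ` {N..})"
    by (rule complex_vector.span_base) auto
  then have "a *\<^sub>C (e (Suc (N + k)) - s) + t \<in> complex_vector.span (e ` {N..})"
    using s(1) t(1)
    by (intro complex_vector.span_add complex_vector.span_scale complex_vector.span_diff)
  moreover have "a *\<^sub>C x + q = residual_adj e N (a *\<^sub>C (e (Suc (N + k)) - s) + t)"
    using s(2) t(2) by (simp add: residual_adj_add residual_adj_scaleC)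
  ultimately show ?case
    by blast
qed

text \<open>
  An approximant \<open>p\<close> from the span of \<open>{g\<^sub>0} \<union> {g\<^sub>n | n > N}\<close> only improves when its multiple of \<open>g\<^sub>0\<close> is
  dropped, since \<open>w\<close> and all the other \<open>g\<^sub>n\<close> are orthogonal to \<open>g\<^sub>0\<close>.
\<close>

lemma tail_approx:
  assumes "cinner w (g 0) = 0" and "0 < \<epsilon>"
  obtains q where "q \<in> complex_vector.span (g ` {Suc N..})" and "norm (w - q) < \<epsilon>"
proof -
  have "linearly_dense (insert (g 0) (g ` {Suc N..}))"
    using stable by (simp add: stable_normalized_Bessel_def)
  then obtain p where p: "p \<in> complex_vector.span (insert (g 0) (g ` {Suc N..}))"
    "norm (w - p) < \<epsilon>"
    using linearly_dense_approx assms(2) by blast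
  then obtain a where q: "p - a *\<^sub>C g 0 \<in> complex_vector.span (g ` {Suc N..})" (is "?q \<in> _")
    by (auto simp: complex_vector.span_insert)
  have "cinner (g 0) ?q = 0"
    using q by (rule orthogonal_span[rotated]) (auto intro: Bessel_first_orthogonal[OF Bessel])
  then have "cinner (w - ?q) (- (a *\<^sub>C g 0)) = 0"
    using assms(1) cinner_eq_zero_commute[of "g 0" ?q] cinner_diff_right[of "w - ?q" 0 "a *\<^sub>C g 0"]
    by (simp add: cinner_diff_left[of w] cinner_scaleC_right)
  from norm_le_norm_add_orthogonal[OF this] have "norm (w - ?q) \<le> norm (w - p)"
    by simp
  with p(2) q that show thesis
    by force
qed

text \<open>
  Approximate \<open>A\<^sub>N\<^sup>* z\<close> by a combination of later \<open>g\<^sub>n\<close>, which is \<open>A\<^sub>N\<^sup>* s\<close> with \<open>s\<close> in the span. The small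
  error \<open>A\<^sub>N\<^sup>* (z - s)\<close> equals \<open>A\<^sub>N\<^sup>* y\<close> for some small \<open>y\<close>, so \<open>z - s - y\<close> lies in the kernel and is a multiple
  of \<open>e\<^sub>N\<close>.
\<close>

lemma solution_tail_dense:
  assumes solves: "\<And>n. solves_upto g e n"
  shows "linearly_dense (e ` {N..})"
  unfolding linearly_dense_def
proof (intro equalityI subsetI UNIV_I)
  fix z :: 'a
  let ?M = "complex_vector.span (e ` {N..})"
  have first: "e 0 = g 0" "norm (e 0) = 1"
    using solves[of 0] norm_first by (simp_all add: solves_upto_def)
  obtain C where C: "0 < C"
    "\<And>w. cinner w (e 0) = 0 \<Longrightarrow> \<exists>y. residual_adj e N y = w \<and> norm y \<le> C * norm w"
    using residual_adj_open[OF solves] by blast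
  have range: "cinner (residual_adj e N y) (e 0) = 0" for y
    by (metis cinner_eq_zero_commute cinner_residual residual_first[of e, OF first(2)] cinner_zero_left)
  show "z \<in> closure ?M"
    unfolding closure_approachable
  proof (intro allI impI)
    fix \<epsilon> :: real
    assume "0 < \<epsilon>"
    with C(1) have "0 < \<epsilon> / C"
      by simp
    then obtain q where q: "q \<in> complex_vector.span (g ` {Suc N..})"
      "norm (residual_adj e N z - q) < \<epsilon> / C"
      using tail_approx range first(1) by metis
    then obtain s where s: "s \<in> ?M" "q = residual_adj e N s"
      using span_tail_subset_image[OF solves] by blast
    obtain y where y: "residual_adj e N y = residual_adj e N (z - s)"
      "norm y \<le> C * norm (residual_adj e N (z - s))"
      using C(2) range by blast
    have "norm y < \<epsilon>"
    proof -
      have "C * norm (residual_adj e N (z - s)) < \<epsilon>"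
        using q(2) s(2) C(1) by (simp add: residual_adj_diff field_simps)
      with y(2) show ?thesis
        by simp
    qed
    have "residual_adj e N (z - s - y) = 0"
      using y(1) by (simp add: residual_adj_diff)
    then have "project_away (e N) (z - s - y) = 0"
      using kernel_residual_adj[OF solves] by blast
    then obtain c where "z - s - y = c *\<^sub>C e N"
      by (auto simp: project_away_def)
    then have "z - (s + c *\<^sub>C e N) = y"
      by (simp add: algebra_simps)
    moreover have "s + c *\<^sub>C e N \<in> ?M"
      by (intro complex_vector.span_add[OF s(1)] complex_vector.span_scale complex_vector.span_base)
        auto
    ultimately show "\<exists>m\<in>?M. dist m z < \<epsilon>"
      using \<open>norm y < \<epsilon>\<close> by (metis dist_norm norm_minus_commute)
  qed
qed

end

theorem theorem2:
  fixes g :: "nat \<Rightarrow> 'a::complex_hilbert"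
  assumes "stable_normalized_Bessel g"
  shows "(\<exists>!e. admissible_unit_sequence e \<and> generates e g) \<and>
         (\<forall>e. admissible_unit_sequence e \<and> generates e g \<longrightarrow> stable_unit_sequence e)"
proof -
  note solves_iff = admissible_generates_iff_solves[of g, OF norm_first[OF assms]]
  have "\<exists>!e. admissible_unit_sequence e \<and> generates e g"
    unfolding solves_iff
    using solution_exists[OF assms] solution_unique[OF assms] by metis
  moreover have "stable_unit_sequence e"
    if "admissible_unit_sequence e \<and> generates e g" for e
    using that solution_tail_dense[OF assms, of e] solves_iff[of e]
    by (simp add: stable_unit_sequence_def admissible_unit_sequence_def)
  ultimately show ?thesis
    by blast
qed

end
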